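(* Let $G$ be a finite simple undirected graph with nonempty vertex set, and let $H$ be an interval graph that is a supergraph of $G$, i.e. $V(H)=V(G)$ and $E(G)\subseteq E(H)$. Then $$\beta(G)\le 2\,\alpha(G)\,\phi(G,H)\,\bigl(\log_2(\alpha(H))+1\bigr).$$
   Context: For a finite simple undirected graph $G$: $\alpha(G)$ is the size of a largest independent set of $G$; $\beta(G)$ is the clique cover number, i.e. the minimum number of cliques of $G$ whose union is $V(G)$; $G[W]$ is the subgraph of $G$ induced on $W\subseteq V(G)$. An interval graph is a graph isomorphic to the intersection graph of a finite family of intervals on the real line. A graph $H$ is a supergraph of $G$ if $V(H)=V(G)$ and $E(G)\subseteq E(H)$. For a supergraph $H$ of $G$, $$\phi(G,H)=\max\left\{\frac{\beta(G[W])}{\alpha(G[W])} : \emptyset\ne W\subseteq V(G),\ H[W]\text{ is a clique (complete graph)}\right\}.$$ *)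

theory Defs
  imports "HOL-Analysis.Analysis" "HOL-Library.Ramsey"
begin

text \<open>
  A graph is a pair of a vertex set and a set of edges, each edge being a two-element set of
  vertices. \<^const>\<open>clique\<close>, \<^const>\<open>indep\<close> and the notation for two-element subsets are
  those of \<^theory>\<open>HOL-Library.Ramsey\<close>.
\<close>

type_synonym 'a graph = "'a set \<times> 'a set set"

abbreviation verts :: "'a graph \<Rightarrow> 'a set" where
  "verts G \<equiv> fst G"

abbreviation edges :: "'a graph \<Rightarrow> 'a set set" where
  "edges G \<equiv> snd G"

definition finite_simple_graph :: "'a graph \<Rightarrow> bool" where
  "finite_simple_graph G \<longleftrightarrow> finite (verts G) \<and> edges G \<subseteq> [verts G]\<^bsup>2\<^esup>"

definition induced_subgraph :: "'a graph \<Rightarrow> 'a set \<Rightarrow> 'a graph" where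
  "induced_subgraph G W = (W, {e \<in> edges G. e \<subseteq> W})"

definition supergraph :: "'a graph \<Rightarrow> 'a graph \<Rightarrow> bool" where
  "supergraph H G \<longleftrightarrow> verts H = verts G \<and> edges G \<subseteq> edges H"

definition complete_graph :: "'a graph \<Rightarrow> bool" where
  "complete_graph G \<longleftrightarrow> clique (verts G) (edges G)"

definition independence_number :: "'a graph \<Rightarrow> nat" where
  "independence_number G = Max {card S | S. S \<subseteq> verts G \<and> indep S (edges G)}"

definition clique_cover :: "'a graph \<Rightarrow> 'a set set \<Rightarrow> bool" where
  "clique_cover G C \<longleftrightarrow>
     finite C \<and> (\<forall>K\<in>C. K \<subseteq> verts G \<and> clique K (edges G)) \<and> \<Union>C = verts G"

definition clique_cover_number :: "'a graph \<Rightarrow> nat" where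
  "clique_cover_number G = (LEAST k. \<exists>C. clique_cover G C \<and> card C = k)"

definition graph_isomorphic :: "'a graph \<Rightarrow> 'b graph \<Rightarrow> bool" where
  "graph_isomorphic G H \<longleftrightarrow>
     (\<exists>f. bij_betw f (verts G) (verts H) \<and>
          (\<forall>u\<in>verts G. \<forall>v\<in>verts G. {u, v} \<in> edges G \<longleftrightarrow> {f u, f v} \<in> edges H))"

text \<open>The vertices are the indices of the family, so the same set may occur several times.\<close>

definition intersection_graph :: "'i set \<Rightarrow> ('i \<Rightarrow> 'b set) \<Rightarrow> 'i graph" where
  "intersection_graph J S = (J, {{i, j} | i j. i \<in> J \<and> j \<in> J \<and> i \<noteq> j \<and> S i \<inter> S j \<noteq> {}})"

text \<open>
  Indexing by natural numbers is no restriction for a finite family. Intervals are nonempty and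
  may be open, closed, half-open, degenerate or unbounded.
\<close>

definition interval_graph :: "'a graph \<Rightarrow> bool" where
  "interval_graph G \<longleftrightarrow> finite_simple_graph G \<and>
     (\<exists>(J :: nat set) (S :: nat \<Rightarrow> real set).
        finite J \<and> (\<forall>j\<in>J. is_interval (S j) \<and> S j \<noteq> {}) \<and>
        graph_isomorphic G (intersection_graph J S))"

definition phi :: "'a graph \<Rightarrow> 'a graph \<Rightarrow> real" where
  "phi G H = Max {real (clique_cover_number (induced_subgraph G W)) /
                  real (independence_number (induced_subgraph G W)) | W.
                    W \<noteq> {} \<and> W \<subseteq> verts G \<and> complete_graph (induced_subgraph H W)}"

end

theory Submission
  imports Defs
begin

text \<open>
  The proof is divide and conquer along the line. Write \<open>\<alpha>\<close> and \<open>\<beta>\<close> for the independence and the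
  clique cover number of an induced subgraph. In an interval representation of \<open>H\<close> by closed
  intervals, every point \<open>p\<close> of the line splits a vertex set \<open>V\<close> into the vertices \<open>L\<close> whose
  interval lies to the left of \<open>p\<close>, the vertices \<open>R\<close> whose interval lies to the right, and the
  vertices \<open>M\<close> whose interval contains \<open>p\<close>. The set \<open>M\<close> is a clique of \<open>H\<close>, so
  \<open>\<beta>(G[M]) \<le> \<phi> \<alpha>(G[M])\<close>. There is no edge of \<open>H\<close>, hence none of \<open>G\<close>, between \<open>L\<close> and \<open>R\<close>, so
  \<open>\<alpha>\<close> is superadditive on them, both in \<open>G\<close> and in \<open>H\<close>.

  Superadditivity in \<open>H\<close> gives a median point (\<open>median_clique_separator\<close>): if \<open>\<alpha>(H[V]) < 2 ^ (m+1)\<close>,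
  then some \<open>p\<close> leaves \<open>\<alpha>(H[L])\<close> and \<open>\<alpha>(H[R])\<close> both below \<open>2 ^ m\<close>. Superadditivity in \<open>G\<close> then
  makes the recursion cost only one unit \<open>\<phi> \<alpha>(G[V])\<close> per level, by
  \<open>\<beta>(G[V]) \<le> \<beta>(G[L]) + \<beta>(G[R]) + \<beta>(G[M]) \<le> m \<phi> (\<alpha>(G[L]) + \<alpha>(G[R])) + \<phi> \<alpha>(G[M])
   \<le> (m + 1) \<phi> \<alpha>(G[V])\<close>
  (\<open>clique_cover_number_le_levels\<close>). As \<open>\<lfloor>log 2 \<alpha>(H)\<rfloor> + 1\<close> levels suffice, the asserted bound follows,
  with a factor of 2 to spare.
\<close>

section \<open>Independence number of induced subgraphs\<close>

abbreviation ind_num :: "'a graph \<Rightarrow> 'a set \<Rightarrow> nat" where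
  "ind_num G W \<equiv> independence_number (induced_subgraph G W)"

abbreviation cov_num :: "'a graph \<Rightarrow> 'a set \<Rightarrow> nat" where
  "cov_num G W \<equiv> clique_cover_number (induced_subgraph G W)"

lemma verts_induced_subgraph [simp]: "verts (induced_subgraph G W) = W"
  by (simp add: induced_subgraph_def)

lemma induced_subgraph_verts:
  assumes "finite_simple_graph G"
  shows "induced_subgraph G (verts G) = G"
  using assms
  by (cases G) (auto simp: induced_subgraph_def finite_simple_graph_def nsets_def)

lemma indep_induced_subgraph:
  assumes "S \<subseteq> W"
  shows "indep S (edges (induced_subgraph G W)) \<longleftrightarrow> indep S (edges G)"
  using assms by (fastforce simp: induced_subgraph_def indep_def)

lemma clique_induced_subgraph:
  assumes "K \<subseteq> W"
  shows "clique K (edges (induced_subgraph G W)) \<longleftrightarrow> clique K (edges G)"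
  using assms by (fastforce simp: induced_subgraph_def clique_def)

lemma ind_num_eq_Max:
  "ind_num G W = Max {card S | S. S \<subseteq> W \<and> indep S (edges G)}"
proof -
  have "{card S | S. S \<subseteq> W \<and> indep S (edges (induced_subgraph G W))}
      = {card S | S. S \<subseteq> W \<and> indep S (edges G)}"
    using indep_induced_subgraph by blast
  then show ?thesis
    by (simp add: independence_number_def)
qed

lemma card_indep_le_ind_num:
  assumes "finite W" "S \<subseteq> W" "indep S (edges G)"
  shows "card S \<le> ind_num G W"
proof -
  have "finite {card S | S. S \<subseteq> W \<and> indep S (edges G)}"
    using assms(1) by simp
  then show ?thesis
    unfolding ind_num_eq_Max using assms by (intro Max_ge) blast+
qed

lemma obtain_max_indep:
  assumes "finite W"
  obtains S where "S \<subseteq> W" "indep S (edges G)" "card S = ind_num G W"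
proof -
  let ?A = "{card S | S. S \<subseteq> W \<and> indep S (edges G)}"
  have "indep {} (edges G)"
    by (simp add: indep_def)
  then have "?A \<noteq> {}"
    by blast
  moreover have "finite ?A"
    using assms by simp
  ultimately have "ind_num G W \<in> ?A"
    unfolding ind_num_eq_Max by (rule Max_in[rotated])
  then obtain S where "ind_num G W = card S" "S \<subseteq> W" "indep S (edges G)"
    by blast
  then show ?thesis
    using that by simp
qed

lemma ind_num_mono:
  assumes "finite W" "U \<subseteq> W"
  shows "ind_num G U \<le> ind_num G W"
  by (metis assms card_indep_le_ind_num finite_subset obtain_max_indep subset_trans)

lemma ind_num_empty [simp]: "ind_num G {} = 0"
  by (metis card.empty finite.emptyI obtain_max_indep subset_empty)

lemma ind_num_pos:
  assumes "finite W" "W \<noteq> {}"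
  shows "0 < ind_num G W"
proof -
  obtain x where "x \<in> W"
    using assms by blast
  then have "card {x} \<le> ind_num G W"
    using assms by (intro card_indep_le_ind_num) (auto simp: indep_def)
  then show ?thesis
    by simp
qed

text \<open>
  Independent sets of two vertex sets without edges between them combine to an independent set.
\<close>

lemma ind_num_superadditive:
  assumes "finite W" "A \<subseteq> W" "B \<subseteq> W" "A \<inter> B = {}"
    and no_edge: "\<And>u v. u \<in> A \<Longrightarrow> v \<in> B \<Longrightarrow> {u, v} \<notin> edges G"
  shows "ind_num G A + ind_num G B \<le> ind_num G W"
proof -
  have fin: "finite A" "finite B"
    using assms finite_subset by blast+
  obtain S where S: "S \<subseteq> A" "indep S (edges G)" "card S = ind_num G A"
    using obtain_max_indep fin by blast
  obtain T where T: "T \<subseteq> B" "indep T (edges G)" "card T = ind_num G B"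
    using obtain_max_indep fin by blast
  have "{v, u} \<notin> edges G" if "u \<in> A" "v \<in> B" for u v
    using no_edge[OF that] by (simp add: insert_commute)
  then have "indep (S \<union> T) (edges G)"
    using S T no_edge unfolding indep_def by blast
  moreover have "card (S \<union> T) = card S + card T"
    using S T fin assms(4) by (intro card_Un_disjoint) (auto intro: finite_subset)
  moreover have "S \<union> T \<subseteq> W"
    using S T assms by blast
  ultimately show ?thesis
    using S T card_indep_le_ind_num[OF assms(1)] by metis
qed

section \<open>Clique cover number of induced subgraphs\<close>

lemma clique_cover_induced_subgraph:
  "clique_cover (induced_subgraph G W) C \<longleftrightarrow>
     finite C \<and> (\<forall>K\<in>C. K \<subseteq> W \<and> clique K (edges G)) \<and> \<Union>C = W"
  by (simp add: clique_cover_def clique_induced_subgraph cong: conj_cong)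

lemma cov_num_le:
  assumes "clique_cover (induced_subgraph G W) C"
  shows "cov_num G W \<le> card C"
  unfolding clique_cover_number_def using assms by (intro Least_le) blast

lemma obtain_min_clique_cover:
  assumes "finite W"
  obtains C where "clique_cover (induced_subgraph G W) C" "card C = cov_num G W"
proof -
  have "clique_cover (induced_subgraph G W) ((\<lambda>x. {x}) ` W)"
    using assms by (auto simp: clique_cover_induced_subgraph clique_def)
  then have "\<exists>k C. clique_cover (induced_subgraph G W) C \<and> card C = k"
    by blast
  from LeastI_ex[OF this] show ?thesis
    using that unfolding clique_cover_number_def by blast
qed

lemma cov_num_empty [simp]: "cov_num G {} = 0"
  using cov_num_le[of G "{}" "{}"] by (simp add: clique_cover_induced_subgraph)

lemma cov_num_Un_le:
  assumes "finite A" "finite B"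
  shows "cov_num G (A \<union> B) \<le> cov_num G A + cov_num G B"
proof -
  obtain C where C: "clique_cover (induced_subgraph G A) C" "card C = cov_num G A"
    using obtain_min_clique_cover assms by blast
  obtain D where D: "clique_cover (induced_subgraph G B) D" "card D = cov_num G B"
    using obtain_min_clique_cover assms by blast
  have "clique_cover (induced_subgraph G (A \<union> B)) (C \<union> D)"
    using C(1) D(1) unfolding clique_cover_induced_subgraph by blast
  from cov_num_le[OF this] show ?thesis
    using C D card_Un_le[of C D] by linarith
qed

section \<open>Interval representations and median separators\<close>

definition closed_interval_rep ::
  "'a graph \<Rightarrow> 'a set \<Rightarrow> ('a \<Rightarrow> real) \<Rightarrow> ('a \<Rightarrow> real) \<Rightarrow> bool" where
  "closed_interval_rep H V l r \<longleftrightarrow>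
     (\<forall>u\<in>V. l u \<le> r u) \<and>
     (\<forall>u\<in>V. \<forall>v\<in>V. u \<noteq> v \<longrightarrow> ({u, v} \<in> edges H \<longleftrightarrow> l u \<le> r v \<and> l v \<le> r u))"

text \<open>
  The intervals of a finite family can be shrunk to compact ones without changing which pairs meet:
  pick one point in each nonempty pairwise intersection and replace each interval by the convex
  hull of the picked points that it contains.
\<close>

lemma interval_graph_closed_interval_rep:
  assumes "interval_graph H"
  obtains l r where "closed_interval_rep H (verts H) l r"
proof -
  obtain J :: "nat set" and S :: "nat \<Rightarrow> real set"
    where J: "finite J" and S: "\<And>j. j \<in> J \<Longrightarrow> is_interval (S j) \<and> S j \<noteq> {}"
      and iso: "graph_isomorphic H (intersection_graph J S)"
    using assms unfolding interval_graph_def by blast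
  obtain f where f: "bij_betw f (verts H) J"
    and edge: "\<And>u v. u \<in> verts H \<Longrightarrow> v \<in> verts H \<Longrightarrow>
      {u, v} \<in> edges H \<longleftrightarrow> {f u, f v} \<in> edges (intersection_graph J S)"
    using iso unfolding graph_isomorphic_def by (auto simp: intersection_graph_def)
  have fJ: "f u \<in> J" if "u \<in> verts H" for u
    using f that by (auto simp: bij_betw_def)
  define c where "c i j = (SOME x. x \<in> S i \<inter> S j)" for i j
  have c: "c i j \<in> S i \<inter> S j" if "S i \<inter> S j \<noteq> {}" for i j
    unfolding c_def by (rule some_in_eq[THEN iffD2]) (rule that)
  define P where "P i = (\<Union>j\<in>J. \<Union>k\<in>J. {c j k}) \<inter> S i" for i
  have P: "finite (P i)" "P i \<subseteq> S i" for i
    using J by (auto simp: P_def)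
  have cP: "c i j \<in> P i" "c i j \<in> P j" if "i \<in> J" "j \<in> J" "S i \<inter> S j \<noteq> {}" for i j
    using c[OF that(3)] that by (auto simp: P_def)
  have P_ne: "P i \<noteq> {}" if "i \<in> J" for i
    using cP[of i i] S[of i] that by auto
  define a b where "a i = Min (P i)" and "b i = Max (P i)" for i
  have ab: "a i \<in> S i" "b i \<in> S i" if "i \<in> J" for i
    using P[of i] P_ne[OF that] Min_in[of "P i"] Max_in[of "P i"]
    unfolding a_def b_def by blast+
  have between: "a i \<le> x" "x \<le> b i" if "x \<in> P i" for x i
    using P that by (auto simp: a_def b_def)
  have inside: "x \<in> S i" if "i \<in> J" "a i \<le> x" "x \<le> b i" for x i
    using S[OF that(1)] ab[OF that(1)] that by (meson is_interval_1)
  have meet: "S i \<inter> S j \<noteq> {} \<longleftrightarrow> a i \<le> b j \<and> a j \<le> b i" if ij: "i \<in> J" "j \<in> J" for i j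
  proof
    assume "S i \<inter> S j \<noteq> {}"
    then show "a i \<le> b j \<and> a j \<le> b i"
      using cP[OF ij] between by (meson order_trans)
  next
    assume le: "a i \<le> b j \<and> a j \<le> b i"
    have "a i \<le> b i" "a j \<le> b j"
      using P_ne between ij by (meson all_not_in_conv order_trans)+
    with le have "max (a i) (a j) \<in> S i \<inter> S j"
      using inside[of i "max (a i) (a j)"] inside[of j "max (a i) (a j)"] ij by auto
    then show "S i \<inter> S j \<noteq> {}"
      by blast
  qed
  have "{u, v} \<in> edges H \<longleftrightarrow> a (f u) \<le> b (f v) \<and> a (f v) \<le> b (f u)"
    if uv: "u \<in> verts H" "v \<in> verts H" "u \<noteq> v" for u v
  proof -
    have "f u \<noteq> f v"
      using f uv by (auto simp: bij_betw_def inj_on_def)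
    then have "{f u, f v} \<in> edges (intersection_graph J S) \<longleftrightarrow> S (f u) \<inter> S (f v) \<noteq> {}"
      using fJ uv by (auto simp: intersection_graph_def doubleton_eq_iff)
    then show ?thesis
      using edge meet fJ uv by simp
  qed
  moreover have "a (f u) \<le> b (f u)" if "u \<in> verts H" for u
    using P_ne[OF fJ[OF that]] between by (meson all_not_in_conv order_trans)
  ultimately have "closed_interval_rep H (verts H) (a \<circ> f) (b \<circ> f)"
    by (simp add: closed_interval_rep_def)
  then show ?thesis
    using that by blast
qed

lemma closed_interval_rep_subset:
  assumes "closed_interval_rep H V l r" "U \<subseteq> V"
  shows "closed_interval_rep H U l r"
  using assms by (simp add: closed_interval_rep_def subset_iff)

text \<open>
  The separating point is found by a sweep from the left: it is the least right endpoint \<open>p\<close> such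
  that the intervals ending at \<open>p\<close> or earlier contain \<open>s\<close> pairwise disjoint ones. The
  intervals ending strictly before \<open>p\<close> contain fewer, and since the intervals that start after \<open>p\<close>
  miss all those that end by \<open>p\<close>, fewer than \<open>t\<close> pairwise disjoint ones remain on the right.
\<close>

lemma median_clique_separator:
  assumes V: "finite V" and rep: "closed_interval_rep H V l r"
    and less: "ind_num H V < s + t" and pos: "0 < s" "0 < t"
  obtains L M R where "V = L \<union> R \<union> M" "L \<inter> R = {}" "clique M (edges H)"
    "\<And>u v. u \<in> L \<Longrightarrow> v \<in> R \<Longrightarrow> {u, v} \<notin> edges H"
    "ind_num H L < s" "ind_num H R < t"
proof -
  have ord: "l u \<le> r u" if "u \<in> V" for u
    using rep that by (simp add: closed_interval_rep_def)
  have edge: "{u, v} \<in> edges H \<longleftrightarrow> l u \<le> r v \<and> l v \<le> r u"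
    if "u \<in> V" "v \<in> V" "u \<noteq> v" for u v
    using rep that by (simp add: closed_interval_rep_def)
  show thesis
  proof (cases "ind_num H V < s")
    case True
    show thesis
      by (rule that[of V "{}" "{}"]) (use True pos in \<open>auto simp: clique_def\<close>)
  next
    case False
    define upto where "upto p = {u \<in> V. r u \<le> p}" for p
    define Q where "Q = {p \<in> r ` V. s \<le> ind_num H (upto p)}"
    have V_ne: "V \<noteq> {}"
      using False pos by auto
    have "upto (Max (r ` V)) = V"
      using V by (auto simp: upto_def)
    then have "Max (r ` V) \<in> Q"
      using False V V_ne by (auto simp: Q_def)
    then have Q: "finite Q" "Q \<noteq> {}"
      using V by (auto simp: Q_def)
    define p where "p = Min Q"
    have p: "s \<le> ind_num H (upto p)"
      using Min_in[OF Q] by (simp add: p_def Q_def)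
    define L R M where "L = {u \<in> V. r u < p}" and "R = {u \<in> V. p < l u}"
      and "M = {u \<in> V. l u \<le> p \<and> p \<le> r u}"
    have apart: "{u, v} \<notin> edges H" if "u \<in> upto p" "v \<in> R" for u v
      using edge[of u v] ord[of v] that by (fastforce simp: upto_def R_def)
    have "L \<subseteq> upto p"
      by (auto simp: L_def upto_def)
    have "ind_num H L < s"
    proof (cases "L = {}")
      case True
      with pos show ?thesis by simp
    next
      case False
      define q where "q = Max (r ` L)"
      have "finite L"
        using V by (simp add: L_def)
      then have "q \<in> r ` L"
        unfolding q_def using False by (intro Max_in) auto
      then have q: "q \<in> r ` V" "q < p"
        by (auto simp: L_def)
      have "r u \<le> q" if "u \<in> L" for u
        unfolding q_def using \<open>finite L\<close> that by (intro Max_ge) auto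
      then have "L = upto q"
        using q by (auto simp: L_def upto_def)
      moreover have "q \<notin> Q"
        using q Q by (auto simp: p_def)
      ultimately show ?thesis
        using q by (simp add: Q_def)
    qed
    moreover have "ind_num H R < t"
    proof -
      have "upto p \<inter> R = {}"
        using ord by (fastforce simp: upto_def R_def)
      then have "ind_num H (upto p) + ind_num H R \<le> ind_num H V"
        using V apart by (intro ind_num_superadditive) (auto simp: upto_def R_def)
      with p less show ?thesis by linarith
    qed
    moreover have "V = L \<union> R \<union> M"
      by (auto simp: L_def R_def M_def)
    moreover have "L \<inter> R = {}"
      using ord by (fastforce simp: L_def R_def)
    moreover have "clique M (edges H)"
      using edge by (fastforce simp: clique_def M_def)
    moreover have "{u, v} \<notin> edges H" if "u \<in> L" "v \<in> R" for u v
      using apart that \<open>L \<subseteq> upto p\<close> by blast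
    ultimately show thesis
      by (rule_tac that)
  qed
qed

section \<open>The recursion\<close>

text \<open>
  Each of the \<open>m\<close> levels of the recursion is charged \<open>c \<alpha>(G[V])\<close>: the two sides of a median separator
  share a single budget for the remaining levels, because their independence numbers in \<open>G\<close> add up
  to at most \<open>\<alpha>(G[V])\<close>, and the separator itself pays for the current level. The constant \<open>c\<close>
  stands for \<open>\<phi>(G, H)\<close>; leaving it abstract lets \<open>V\<close> shrink while the bound on cliques of \<open>H\<close>
  is inherited.
\<close>

lemma clique_cover_number_le_levels:
  fixes c :: real
  assumes "finite V" "closed_interval_rep H V l r" "edges G \<subseteq> edges H" "0 \<le> c"
    and "\<And>W. W \<subseteq> V \<Longrightarrow> clique W (edges H) \<Longrightarrow> real (cov_num G W) \<le> c * ind_num G W"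
    and "ind_num H V < 2 ^ m"
  shows "real (cov_num G V) \<le> m * c * ind_num G V"
  using assms
proof (induction m arbitrary: V)
  case 0
  then have "V = {}"
    using ind_num_pos[of V H] by fastforce
  then show ?case by simp
next
  case (Suc m)
  note V = Suc.prems(1) and rep = Suc.prems(2) and GH = Suc.prems(3) and c = Suc.prems(4)
    and clique_bound = Suc.prems(5)
  have "ind_num H V < 2 ^ m + 2 ^ m"
    using Suc.prems(6) by simp
  then obtain L M R where V_eq: "V = L \<union> R \<union> M" and disj: "L \<inter> R = {}"
    and M: "clique M (edges H)"
    and apart: "\<And>u v. u \<in> L \<Longrightarrow> v \<in> R \<Longrightarrow> {u, v} \<notin> edges H"
    and small: "ind_num H L < 2 ^ m" "ind_num H R < 2 ^ m"
    by (rule median_clique_separator[OF V rep]) auto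
  have sub: "L \<subseteq> V" "R \<subseteq> V" "M \<subseteq> V"
    using V_eq by auto
  have fin: "finite L" "finite R" "finite M"
    using sub V finite_subset by blast+
  have IH: "real (cov_num G U) \<le> m * c * ind_num G U" if "U \<subseteq> V" "ind_num H U < 2 ^ m" for U
  proof (rule Suc.IH)
    show "finite U"
      using that V finite_subset by blast
    show "closed_interval_rep H U l r"
      using rep that(1) by (rule closed_interval_rep_subset)
    show "real (cov_num G W) \<le> c * ind_num G W" if "W \<subseteq> U" "clique W (edges H)" for W
      using clique_bound that \<open>U \<subseteq> V\<close> by blast
  qed (use GH c that in auto)
  have "cov_num G V \<le> cov_num G (L \<union> R) + cov_num G M"
    unfolding V_eq using fin by (intro cov_num_Un_le) auto
  also have "cov_num G (L \<union> R) \<le> cov_num G L + cov_num G R"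
    using fin by (intro cov_num_Un_le)
  finally have "real (cov_num G V) \<le> real (cov_num G L) + real (cov_num G R) + real (cov_num G M)"
    by linarith
  also have "\<dots> \<le> m * c * ind_num G L + m * c * ind_num G R + c * ind_num G M"
    by (intro add_mono IH clique_bound sub small M)
  also have "\<dots> = m * c * real (ind_num G L + ind_num G R) + c * ind_num G M"
    by (simp add: algebra_simps)
  also have "\<dots> \<le> m * c * ind_num G V + c * ind_num G V"
  proof (intro add_mono mult_left_mono)
    have "ind_num G L + ind_num G R \<le> ind_num G V"
      using V sub disj apart GH by (intro ind_num_superadditive) auto
    then show "real (ind_num G L + ind_num G R) \<le> real (ind_num G V)"
      by simp
    show "real (ind_num G M) \<le> real (ind_num G V)"
      using ind_num_mono[OF V sub(3)] by simp
  qed (use c in auto)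
  also have "\<dots> = Suc m * c * ind_num G V"
    by (simp add: algebra_simps)
  finally show ?case .
qed

lemma cov_num_ratio_le_phi:
  assumes "finite (verts G)" "W \<noteq> {}" "W \<subseteq> verts G" "clique W (edges H)"
  shows "cov_num G W / ind_num G W \<le> phi G H"
proof -
  have "finite {cov_num G W / ind_num G W | W.
      W \<noteq> {} \<and> W \<subseteq> verts G \<and> complete_graph (induced_subgraph H W)}"
    using assms(1) by simp
  then show ?thesis
    unfolding phi_def using assms
    by (intro Max_ge) (auto simp: complete_graph_def clique_induced_subgraph)
qed

theorem theorem1p1:
  fixes G H :: "'a graph"
  assumes "finite_simple_graph G"
    and "verts G \<noteq> {}"
    and "interval_graph H"
    and "supergraph H G"
  shows "real (clique_cover_number G)
           \<le> 2 * real (independence_number G) * phi G H *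
             (log 2 (real (independence_number H)) + 1)"
proof -
  define V where "V = verts G"
  have V: "finite V" "V \<noteq> {}" and VH: "verts H = V" and GH: "edges G \<subseteq> edges H"
    using assms by (auto simp: V_def finite_simple_graph_def supergraph_def)
  have G_eq: "induced_subgraph G V = G"
    using assms(1) by (simp add: V_def induced_subgraph_verts)
  have H_eq: "induced_subgraph H V = H"
    using assms(3) induced_subgraph_verts[of H] by (simp add: VH interval_graph_def)
  obtain l r where rep: "closed_interval_rep H V l r"
    using interval_graph_closed_interval_rep[OF assms(3)] VH by metis
  have ratio: "cov_num G W / ind_num G W \<le> phi G H"
    if "W \<noteq> {}" "W \<subseteq> V" "clique W (edges H)" for W
    using that V by (intro cov_num_ratio_le_phi) (auto simp: V_def)
  obtain x where x: "x \<in> V"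
    using V by blast
  have phi: "0 \<le> phi G H"
  proof (rule order_trans)
    show "0 \<le> real (cov_num G {x}) / ind_num G {x}"
      by simp
    show "real (cov_num G {x}) / ind_num G {x} \<le> phi G H"
      using x by (intro ratio) (auto simp: clique_def)
  qed
  have clique_bound: "real (cov_num G W) \<le> phi G H * ind_num G W"
    if "W \<subseteq> V" "clique W (edges H)" for W
  proof (cases "W = {}")
    case False
    then have "0 < ind_num G W"
      using that V finite_subset ind_num_pos by blast
    then show ?thesis
      using ratio[OF False that] by (simp add: pos_divide_le_eq)
  qed simp
  define k where "k = independence_number H"
  have k: "1 \<le> k"
    using ind_num_pos[OF V, of H] by (simp add: k_def H_eq)
  define m where "m = Suc (nat \<lfloor>log 2 k\<rfloor>)"
  have log_nonneg: "0 \<le> log 2 k"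
    using k by simp
  then have m: "log 2 k < m" "m \<le> log 2 k + 1"
    unfolding m_def by linarith+
  have "real k < 2 ^ m"
    using m(1) k by (simp add: log_less_iff powr_realpow)
  then have "ind_num H V < 2 ^ m"
    by (simp add: H_eq k_def)
  from clique_cover_number_le_levels[OF V(1) rep GH phi clique_bound this]
  have "real (clique_cover_number G) \<le> m * (phi G H * independence_number G)"
    by (simp add: G_eq)
  also have "\<dots> \<le> (2 * (log 2 k + 1)) * (phi G H * independence_number G)"
    using m(2) log_nonneg phi by (intro mult_right_mono) auto
  finally show ?thesis
    by (simp add: k_def algebra_simps)
qed

end
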